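(* When the sliding window advances by one item, the forward sketch takes $O(\ell)$ time to update (by the update procedure in the context), where $\ell$ is the number of values of the protected attribute.
   Context: A sliding window $W$ of $|W|$ consecutive stream items is maintained; each item carries one value of a protected attribute with $\ell$ values $p_1,\dots,p_\ell$. The forward sketch is a list $S$ of $|W|$ vectors of length $\ell-1$, the entries of which record cumulative counts: for the first window $\{t_1,\dots,t_{|W|}\}$, $S[i][j]$ is the number of items among $t_1,\dots,t_i$ with value $p_j$ ($1\le j\le \ell-1$). Update procedure when the window slides by one item (the oldest item leaves and one new item with value $p$ arrives): all entries of the sketch are shifted one position to the left, the first entry being removed; a new last entry is appended, equal to the previous last entry with coordinate $j$ increased by $1$ if $p=p_j$ for some $j\le \ell-1$ (and unchanged if $p=p_\ell$). *)

theory Defs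
  imports Complex_Main "HOL-Library.Landau_Symbols"
begin

text \<open>
  The attribute values \<open>p\<^sub>1, \<dots>, p\<^sub>l\<close> are represented by their indices \<open>1, \<dots>, l\<close>.
  A stream \<open>t\<close> is indexed from \<open>1\<close>: \<open>t i\<close> is the value carried by the item \<open>t\<^sub>i\<close>
  (\<open>t 0\<close> is not used).  Lists are indexed from \<open>0\<close>, so \<open>S[i][j]\<close> is \<open>S ! (i - 1) ! (j - 1)\<close>.
\<close>

definition initial_sketch :: "nat \<Rightarrow> nat \<Rightarrow> (nat \<Rightarrow> nat) \<Rightarrow> nat list list" where
  "initial_sketch l w t =
     map (\<lambda>i. map (\<lambda>j. card {k \<in> {1..i}. t k = j}) [1..<l]) [1..<Suc w]"

definition slide :: "nat \<Rightarrow> nat \<Rightarrow> nat list list \<Rightarrow> nat list list" where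
  "slide l p S =
     tl S @ [let v = last S in if p < l then v[p - 1 := Suc (v ! (p - 1))] else v]"

text \<open>\<open>forward_sketch l w t k\<close> is the sketch once the window is \<open>t\<^bsub>k+1\<^esub>, \<dots>, t\<^bsub>k+w\<^esub>\<close>.\<close>

primrec forward_sketch :: "nat \<Rightarrow> nat \<Rightarrow> (nat \<Rightarrow> nat) \<Rightarrow> nat \<Rightarrow> nat list list" where
  "forward_sketch l w t 0 = initial_sketch l w t"
| "forward_sketch l w t (Suc k) = slide l (t (w + k + 1)) (forward_sketch l w t k)"


text \<open>
  The cost model is a unit-cost random access machine: a fixed program works on named
  registers and on an indirectly addressed memory, both holding natural numbers.  Every
  assignment, addition, subtraction, load, store and comparison costs one time unit.
\<close>

type_synonym vname = string

datatype operand = N nat | V vname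

datatype com =
    Skip
  | Assign vname operand
  | Add vname operand operand
  | Sub vname operand operand
  | Load vname operand  \<comment> \<open>the operand is the address\<close>
  | Store operand operand  \<comment> \<open>address, then stored value\<close>
  | Seq com com  (infixr ";;" 60)
  | IfLess operand operand com com
  | WhileLess operand operand com

record state =
  reg :: "vname \<Rightarrow> nat"
  mem :: "nat \<Rightarrow> nat"

fun val :: "state \<Rightarrow> operand \<Rightarrow> nat" where
  "val s (N n) = n"
| "val s (V x) = reg s x"

definition set_reg :: "vname \<Rightarrow> nat \<Rightarrow> state \<Rightarrow> state" where
  "set_reg x n s = s\<lparr>reg := (reg s)(x := n)\<rparr>"

definition set_mem :: "nat \<Rightarrow> nat \<Rightarrow> state \<Rightarrow> state" where
  "set_mem a n s = s\<lparr>mem := (mem s)(a := n)\<rparr>"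

text \<open>\<open>exec c s n s'\<close>: started in \<open>s\<close>, the command \<open>c\<close> halts in \<open>s'\<close> after \<open>n\<close> time units.\<close>

inductive exec :: "com \<Rightarrow> state \<Rightarrow> nat \<Rightarrow> state \<Rightarrow> bool" where
  Skip: "exec Skip s 0 s"
| Assign: "exec (Assign x a) s 1 (set_reg x (val s a) s)"
| Add: "exec (Add x a b) s 1 (set_reg x (val s a + val s b) s)"
| Sub: "exec (Sub x a b) s 1 (set_reg x (val s a - val s b) s)"
| Load: "exec (Load x a) s 1 (set_reg x (mem s (val s a)) s)"
| Store: "exec (Store a b) s 1 (set_mem (val s a) (val s b) s)"
| Seq: "exec c1 s1 m s2 \<Longrightarrow> exec c2 s2 n s3 \<Longrightarrow> exec (c1 ;; c2) s1 (m + n) s3"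
| IfTrue: "val s a < val s b \<Longrightarrow> exec c1 s n s' \<Longrightarrow> exec (IfLess a b c1 c2) s (Suc n) s'"
| IfFalse: "\<not> val s a < val s b \<Longrightarrow> exec c2 s n s' \<Longrightarrow> exec (IfLess a b c1 c2) s (Suc n) s'"
| WhileFalse: "\<not> val s a < val s b \<Longrightarrow> exec (WhileLess a b c) s 1 s"
| WhileTrue: "val s1 a < val s1 b \<Longrightarrow> exec c s1 m s2 \<Longrightarrow> exec (WhileLess a b c) s2 n s3
    \<Longrightarrow> exec (WhileLess a b c) s1 (Suc (m + n)) s3"

inductive_cases exec_elims:
  "exec Skip s n s'"
  "exec (Assign x a) s n s'"
  "exec (Add x a b) s n s'"
  "exec (Sub x a b) s n s'"
  "exec (Load x a) s n s'"
  "exec (Store a b) s n s'"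
  "exec (c1 ;; c2) s n s'"
  "exec (IfLess a b c1 c2) s n s'"

inductive_cases exec_WhileE: "exec (WhileLess a b c) s n s'"

text \<open>So a halting run from \<open>s\<close> is the only one, and its running time is well defined.\<close>

lemma exec_deterministic:
  "exec c s n s' \<Longrightarrow> exec c s n' s'' \<Longrightarrow> n' = n \<and> s'' = s'"
proof (induction arbitrary: n' s'' rule: exec.induct)
  case (WhileFalse s a b c)
  then show ?case by (auto elim: exec_WhileE)
next
  case (WhileTrue s1 a b c m s2 n s3)
  obtain m' s2' k where "exec c s1 m' s2'" "exec (WhileLess a b c) s2' k s''" "n' = Suc (m' + k)"
    using WhileTrue.prems WhileTrue.hyps(1) by (auto elim: exec_WhileE)
  with WhileTrue.IH show ?case by blast
qed (elim exec_elims; fastforce)+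


text \<open>
  The sketch is kept in a circular buffer of \<open>w\<close> rows of \<open>m = l - 1\<close> cells, occupying the
  addresses below \<open>w * m\<close>.  The registers \<open>head\<close> and \<open>last\<close> hold the addresses of the rows
  of the first and of the last entry, so shifting all entries one position to the left and
  removing the first one amounts to advancing \<open>head\<close> by one row; no entry is moved.
\<close>

definition stores :: "nat \<Rightarrow> nat \<Rightarrow> state \<Rightarrow> nat list list \<Rightarrow> bool" where
  "stores l w s S \<longleftrightarrow>
     length S = w \<and> (\<forall>v \<in> set S. length v = l - 1) \<and>
     reg s ''m'' = l - 1 \<and> reg s ''end'' = w * (l - 1) \<and>
     (\<exists>h<w. reg s ''head'' = h * (l - 1) \<and>
            reg s ''last'' = ((h + (w - 1)) mod w) * (l - 1) \<and>
            (\<forall>i<w. \<forall>j<l - 1. mem s (((h + i) mod w) * (l - 1) + j) = S ! i ! j))"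

text \<open>
  The update procedure; register \<open>p\<close> holds the value of the arriving item.  The row of the
  removed first entry is reused for the new last entry.
\<close>

definition update_prog :: com where
  "update_prog =
     Assign ''src'' (V ''last'') ;;
     Assign ''dst'' (V ''head'') ;;
     Add ''next'' (V ''head'') (V ''m'') ;;
     WhileLess (V ''dst'') (V ''next'')
       (Load ''x'' (V ''src'') ;;
        Store (V ''dst'') (V ''x'') ;;
        Add ''src'' (V ''src'') (N 1) ;;
        Add ''dst'' (V ''dst'') (N 1)) ;;
     IfLess (V ''m'') (V ''p'')
       Skip
       (Add ''dst'' (V ''head'') (V ''p'') ;;
        Sub ''dst'' (V ''dst'') (N 1) ;;
        Load ''x'' (V ''dst'') ;;
        Add ''x'' (V ''x'') (N 1) ;;
        Store (V ''dst'') (V ''x'')) ;;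
     Assign ''last'' (V ''head'') ;;
     Assign ''head'' (V ''next'') ;;
     IfLess (V ''head'') (V ''end'') Skip (Assign ''head'' (N 0))"

end

theory Submission
  imports Defs
begin

text \<open>
  Reusing the row of the leaving entry for the arriving one, an update copies one row of
  \<open>l - 1\<close> cells, increments at most one of them, and rotates the two row pointers.  The copying
  loop takes \<open>5 (l - 1) + 1\<close> time units and everything else at most \<open>13\<close>.
\<close>

section \<open>Runs of the program's pieces: cost and effect on memory\<close>

definition copy_loop :: com where
  "copy_loop =
     WhileLess (V ''dst'') (V ''next'')
       (Load ''x'' (V ''src'') ;;
        Store (V ''dst'') (V ''x'') ;;
        Add ''src'' (V ''src'') (N 1) ;;
        Add ''dst'' (V ''dst'') (N 1))"

definition increment :: com where
  "increment =
     IfLess (V ''m'') (V ''p'')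
       Skip
       (Add ''dst'' (V ''head'') (V ''p'') ;;
        Sub ''dst'' (V ''dst'') (N 1) ;;
        Load ''x'' (V ''dst'') ;;
        Add ''x'' (V ''x'') (N 1) ;;
        Store (V ''dst'') (V ''x''))"

definition rotate_head :: com where
  "rotate_head = IfLess (V ''head'') (V ''end'') Skip (Assign ''head'' (N 0))"

lemma update_prog_alt:
  "update_prog =
     Assign ''src'' (V ''last'') ;;
     Assign ''dst'' (V ''head'') ;;
     Add ''next'' (V ''head'') (V ''m'') ;;
     copy_loop ;;
     increment ;;
     Assign ''last'' (V ''head'') ;;
     Assign ''head'' (V ''next'') ;;
     rotate_head"
  by (simp add: update_prog_def copy_loop_def increment_def rotate_head_def)

lemma set_simps [simp]:
  "reg (set_reg x n s) = (reg s)(x := n)" "mem (set_reg x n s) = mem s"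
  "reg (set_mem a n s) = reg s" "mem (set_mem a n s) = (mem s)(a := n)"
  by (simp_all add: set_reg_def set_mem_def)

text \<open>A copy in increasing order may overlap its source only if it moves data downwards.\<close>

lemma exec_copy_loop:
  assumes "reg s ''next'' = reg s ''dst'' + n"
    and "reg s ''dst'' \<le> reg s ''src'' \<or> reg s ''src'' + n \<le> reg s ''dst''"
  shows "\<exists>s'. exec copy_loop s (5 * n + 1) s' \<and>
    (\<forall>y. y \<notin> {''x'', ''src'', ''dst''} \<longrightarrow> reg s' y = reg s y) \<and>
    (\<forall>a. mem s' a = (if reg s ''dst'' \<le> a \<and> a < reg s ''dst'' + n
                     then mem s (reg s ''src'' + (a - reg s ''dst'')) else mem s a))"
  using assms
proof (induction n arbitrary: s)
  case 0
  then have "exec copy_loop s 1 s"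
    unfolding copy_loop_def by (intro exec.WhileFalse) simp
  then show ?case by auto
next
  case (Suc n)
  let ?s1 = "set_reg ''x'' (mem s (reg s ''src'')) s"
  let ?s2 = "set_mem (reg s ''dst'') (mem s (reg s ''src'')) ?s1"
  let ?s3 = "set_reg ''src'' (reg s ''src'' + 1) ?s2"
  let ?s4 = "set_reg ''dst'' (reg s ''dst'' + 1) ?s3"
  \<comment> \<open>After one round both pointers have advanced by 1, so either disjunct of the
    overlap condition carries over to the remaining \<open>n\<close> cells.\<close>
  obtain s' where s': "exec copy_loop ?s4 (5 * n + 1) s'"
    "\<And>y. y \<notin> {''x'', ''src'', ''dst''} \<Longrightarrow> reg s' y = reg ?s4 y"
    "\<And>a. mem s' a = (if reg ?s4 ''dst'' \<le> a \<and> a < reg ?s4 ''dst'' + n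
       then mem ?s4 (reg ?s4 ''src'' + (a - reg ?s4 ''dst'')) else mem ?s4 a)"
    using Suc.IH[of ?s4] Suc.prems by auto
  have "exec (Load ''x'' (V ''src'')) s 1 ?s1"
    using exec.Load[of "''x''" "V ''src''" s] by simp
  moreover have "exec (Store (V ''dst'') (V ''x'')) ?s1 1 ?s2"
    using exec.Store[of "V ''dst''" "V ''x''" ?s1] by simp
  moreover have "exec (Add ''src'' (V ''src'') (N 1)) ?s2 1 ?s3"
    using exec.Add[of "''src''" "V ''src''" "N 1" ?s2] by simp
  moreover have "exec (Add ''dst'' (V ''dst'') (N 1)) ?s3 1 ?s4"
    using exec.Add[of "''dst''" "V ''dst''" "N 1" ?s3] by simp
  ultimately have "exec (Load ''x'' (V ''src'') ;; Store (V ''dst'') (V ''x'') ;;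
      Add ''src'' (V ''src'') (N 1) ;; Add ''dst'' (V ''dst'') (N 1)) s (1 + (1 + (1 + 1))) ?s4"
    by (intro exec.Seq)
  moreover have "val s (V ''dst'') < val s (V ''next'')"
    using Suc.prems by simp
  ultimately have "exec copy_loop s (Suc (1 + (1 + (1 + 1)) + (5 * n + 1))) s'"
    using s'(1) unfolding copy_loop_def by (intro exec.WhileTrue)
  moreover have "mem s' a = (if reg s ''dst'' \<le> a \<and> a < reg s ''dst'' + Suc n
      then mem s (reg s ''src'' + (a - reg s ''dst'')) else mem s a)" for a
  proof (cases "reg s ''dst'' < a \<and> a < reg s ''dst'' + Suc n")
    case True
    \<comment> \<open>The first round has overwritten only cell \<open>dst\<close>, and this cell is
      not a source of a later round: later sources lie above \<open>dst\<close> if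
      \<open>dst \<le> src\<close>, and below it if the source block ends before
      \<open>dst\<close>.\<close>
    then have "reg s ''src'' + (a - reg s ''dst'') \<noteq> reg s ''dst''"
      using Suc.prems(2) by linarith
    with True show ?thesis by (auto simp: s'(3) Suc_diff_Suc)
  qed (auto simp: s'(3))
  moreover have "reg s' y = reg s y" if "y \<notin> {''x'', ''src'', ''dst''}" for y
    using s'(2)[OF that] that by simp
  \<comment> \<open>One test and four instructions per round; the extra 1 is the final failing
    test.\<close>
  moreover have "Suc (1 + (1 + (1 + 1)) + (5 * n + 1)) = 5 * Suc n + 1" by simp
  ultimately show ?case by metis
qed

text \<open>The program computes \<open>head + p - 1\<close> with truncated subtraction, which
  agrees with the cell address \<open>head + (p - 1)\<close> because \<open>1 \<le> p\<close>. The
  bound 6 is the test plus five instructions.\<close>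

lemma exec_increment:
  assumes "1 \<le> reg s ''p''"
  shows "\<exists>n s'. exec increment s n s' \<and> n \<le> 6 \<and>
    (\<forall>y. y \<notin> {''x'', ''dst''} \<longrightarrow> reg s' y = reg s y) \<and>
    (\<forall>a. mem s' a = mem s a +
       (if reg s ''p'' \<le> reg s ''m'' \<and> a = reg s ''head'' + (reg s ''p'' - 1) then 1 else 0))"
proof (cases "reg s ''m'' < reg s ''p''")
  case True
  then have "exec increment s (Suc 0) s"
    unfolding increment_def by (intro exec.IfTrue exec.Skip) simp
  with True show ?thesis by (intro exI[of _ "Suc 0"] exI[of _ s]) auto
next
  case False
  let ?d = "reg s ''head'' + reg s ''p'' - 1"
  let ?s1 = "set_reg ''dst'' (reg s ''head'' + reg s ''p'') s"
  let ?s2 = "set_reg ''dst'' ?d ?s1"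
  let ?s3 = "set_reg ''x'' (mem s ?d) ?s2"
  let ?s4 = "set_reg ''x'' (mem s ?d + 1) ?s3"
  let ?s5 = "set_mem ?d (mem s ?d + 1) ?s4"
  have "exec (Add ''dst'' (V ''head'') (V ''p'')) s 1 ?s1"
    using exec.Add[of "''dst''" "V ''head''" "V ''p''" s] by simp
  moreover have "exec (Sub ''dst'' (V ''dst'') (N 1)) ?s1 1 ?s2"
    using exec.Sub[of "''dst''" "V ''dst''" "N 1" ?s1] by simp
  moreover have "exec (Load ''x'' (V ''dst'')) ?s2 1 ?s3"
    using exec.Load[of "''x''" "V ''dst''" ?s2] by simp
  moreover have "exec (Add ''x'' (V ''x'') (N 1)) ?s3 1 ?s4"
    using exec.Add[of "''x''" "V ''x''" "N 1" ?s3] by simp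
  moreover have "exec (Store (V ''dst'') (V ''x'')) ?s4 1 ?s5"
    using exec.Store[of "V ''dst''" "V ''x''" ?s4] by simp
  ultimately have "exec increment s (Suc (1 + (1 + (1 + (1 + 1))))) ?s5"
    using False unfolding increment_def by (intro exec.IfFalse exec.Seq) simp
  with False assms show ?thesis
    by (intro exI[of _ "Suc (1 + (1 + (1 + (1 + 1))))"] exI[of _ ?s5]) auto
qed

lemma exec_rotate_head:
  "\<exists>n s'. exec rotate_head s n s' \<and> n \<le> 2 \<and> mem s' = mem s \<and>
    reg s' = (reg s)(''head'' := if reg s ''head'' < reg s ''end'' then reg s ''head'' else 0)"
proof (cases "reg s ''head'' < reg s ''end''")
  case True
  then have "exec rotate_head s (Suc 0) s"
    unfolding rotate_head_def by (intro exec.IfTrue exec.Skip) simp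
  with True show ?thesis by (intro exI[of _ "Suc 0"] exI[of _ s]) simp
next
  case False
  then have "exec rotate_head s (Suc 1) (set_reg ''head'' (val s (N 0)) s)"
    unfolding rotate_head_def by (intro exec.IfFalse exec.Assign) simp
  with False show ?thesis by (intro exI[of _ "Suc 1"]) auto
qed

text \<open>The overlap condition of the copy becomes a condition on the two row pointers. The test
  \<open>p \<le> m\<close> of the increment disappears from the description of the memory: since
  \<open>1 \<le> p\<close>, the address \<open>head + (p - 1)\<close> lies in the copied row exactly
  if \<open>p \<le> m\<close>.\<close>

lemma exec_update_prog:
  assumes "1 \<le> reg s ''p''"
    and "reg s ''head'' \<le> reg s ''last'' \<or> reg s ''last'' + reg s ''m'' \<le> reg s ''head''"
  shows "\<exists>n s'. exec update_prog s n s' \<and> n \<le> 5 * reg s ''m'' + 14 \<and>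
    reg s' ''m'' = reg s ''m'' \<and> reg s' ''end'' = reg s ''end'' \<and>
    reg s' ''last'' = reg s ''head'' \<and>
    reg s' ''head'' = (if reg s ''head'' + reg s ''m'' < reg s ''end''
                       then reg s ''head'' + reg s ''m'' else 0) \<and>
    (\<forall>a. mem s' a =
       (if reg s ''head'' \<le> a \<and> a < reg s ''head'' + reg s ''m''
        then mem s (reg s ''last'' + (a - reg s ''head'')) +
          (if a = reg s ''head'' + (reg s ''p'' - 1) then 1 else 0)
        else mem s a))"
proof -
  let ?s1 = "set_reg ''src'' (reg s ''last'') s"
  let ?s2 = "set_reg ''dst'' (reg s ''head'') ?s1"
  let ?s3 = "set_reg ''next'' (reg s ''head'' + reg s ''m'') ?s2"
  have e1: "exec (Assign ''src'' (V ''last'')) s 1 ?s1"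
    using exec.Assign[of "''src''" "V ''last''" s] by simp
  have e2: "exec (Assign ''dst'' (V ''head'')) ?s1 1 ?s2"
    using exec.Assign[of "''dst''" "V ''head''" ?s1] by simp
  have e3: "exec (Add ''next'' (V ''head'') (V ''m'')) ?s2 1 ?s3"
    using exec.Add[of "''next''" "V ''head''" "V ''m''" ?s2] by simp
  obtain s4 where e4: "exec copy_loop ?s3 (5 * reg s ''m'' + 1) s4"
    and r4: "\<And>y. y \<notin> {''x'', ''src'', ''dst''} \<Longrightarrow> reg s4 y = reg ?s3 y"
    and m4: "\<And>a. mem s4 a = (if reg ?s3 ''dst'' \<le> a \<and> a < reg ?s3 ''dst'' + reg s ''m''
       then mem ?s3 (reg ?s3 ''src'' + (a - reg ?s3 ''dst'')) else mem ?s3 a)"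
    using exec_copy_loop[of ?s3 "reg s ''m''"] assms(2) by auto
  obtain n5 s5 where e5: "exec increment s4 n5 s5" "n5 \<le> 6"
    and r5: "\<And>y. y \<notin> {''x'', ''dst''} \<Longrightarrow> reg s5 y = reg s4 y"
    and m5: "\<And>a. mem s5 a = mem s4 a +
       (if reg s4 ''p'' \<le> reg s4 ''m'' \<and> a = reg s4 ''head'' + (reg s4 ''p'' - 1) then 1 else 0)"
    using exec_increment[of s4] assms(1) r4[of "''p''"] by auto
  let ?s6 = "set_reg ''last'' (reg s5 ''head'') s5"
  let ?s7 = "set_reg ''head'' (reg s5 ''next'') ?s6"
  have e6: "exec (Assign ''last'' (V ''head'')) s5 1 ?s6"
    using exec.Assign[of "''last''" "V ''head''" s5] by simp
  have e7: "exec (Assign ''head'' (V ''next'')) ?s6 1 ?s7"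
    using exec.Assign[of "''head''" "V ''next''" ?s6] by simp
  obtain n8 s8 where e8: "exec rotate_head ?s7 n8 s8" "n8 \<le> 2" "mem s8 = mem ?s7"
    "reg s8 = (reg ?s7)(''head'' := if reg ?s7 ''head'' < reg ?s7 ''end''
                                    then reg ?s7 ''head'' else 0)"
    using exec_rotate_head[of ?s7] by blast
  \<comment> \<open>The sum is nested like the right-associated \<open>;;\<close>; with
    \<open>n5 \<le> 6\<close> and \<open>n8 \<le> 2\<close> it is at most
    \<open>5 * m + 14\<close>.\<close>
  have "exec update_prog s (1 + (1 + (1 + (5 * reg s ''m'' + 1 + (n5 + (1 + (1 + n8))))))) s8"
    unfolding update_prog_alt using e1 e2 e3 e4 e5(1) e6 e7 e8(1) by (intro exec.Seq)
  then show ?thesis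
    using assms(1) e5(2) e8(2)
    by (intro exI[of _ "1 + (1 + (1 + (5 * reg s ''m'' + 1 + (n5 + (1 + (1 + n8))))))"] exI[of _ s8])
      (auto simp: e8(3,4) r4 r5 m4 m5)
qed

section \<open>Entries and row lengths of a slid sketch\<close>

lemma length_slide: "S \<noteq> [] \<Longrightarrow> length (slide l p S) = length S"
  by (simp add: slide_def)

lemma nth_slide:
  assumes "i < length S" "1 \<le> p"
  shows "slide l p S ! i =
    (if Suc i < length S then S ! Suc i
     else if p < l then (last S)[p - 1 := Suc (last S ! (p - 1))] else last S)"
  using assms by (auto simp: slide_def nth_append nth_tl Let_def)

lemma length_rows_slide:
  assumes "S \<noteq> []" "\<forall>v \<in> set S. length v = m" "v \<in> set (slide l p S)"
  shows "length v = m"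
proof -
  have "last S \<in> set S" using assms(1) by simp
  with assms show ?thesis
    by (auto simp: slide_def Let_def dest: list.set_sel(2) split: if_splits)
qed

section \<open>Row addresses and the simulation of a slide in the circular buffer\<close>

lemma row_less: "j < m \<Longrightarrow> h < w \<Longrightarrow> h * m + j < w * (m::nat)"
  using mult_le_mono1[of "Suc h" w m] by simp

lemma row_separated: "h < (g::nat) \<Longrightarrow> h * m + m \<le> g * m"
  using mult_le_mono1[of "Suc h" g m] by simp

text \<open>A slide changes only row \<open>h\<close>, that of the old first entry. Advancing the
  head by one row modulo \<open>w\<close> makes old entry \<open>i + 1\<close> the new entry
  \<open>i\<close> without moving it, and row \<open>h\<close> becomes the row of the new last
  entry. Nothing depends on how \<open>S\<close> arose, so the result holds for any stored
  list.\<close>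

lemma exec_update_prog_stores:
  assumes "stores l w s S" "1 \<le> reg s ''p''"
  shows "\<exists>n s'. exec update_prog s n s' \<and> n \<le> 5 * (l - 1) + 14 \<and>
    stores l w s' (slide l (reg s ''p'') S)"
proof -
  define m where "m = l - 1"
  define p where "p = reg s ''p''"
  from assms(1) obtain h where len: "length S = w" "\<forall>v \<in> set S. length v = m"
    and regs: "reg s ''m'' = m" "reg s ''end'' = w * m" and h: "h < w"
    and head: "reg s ''head'' = h * m" and last: "reg s ''last'' = ((h + (w - 1)) mod w) * m"
    and cells: "\<And>i j. i < w \<Longrightarrow> j < m \<Longrightarrow> mem s (((h + i) mod w) * m + j) = S ! i ! j"
    unfolding stores_def m_def by blast
  define g where "g = (h + (w - 1)) mod w"
  have "S \<noteq> []" using len(1) h by auto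
  then have S: "S \<noteq> []" "last S = S ! (w - 1)" using len(1) by (auto simp: last_conv_nth)
  \<comment> \<open>\<open>g\<close> is the row of the last entry, the source of the copy. Distinct
    rows are disjoint; for \<open>w = 1\<close> the rows coincide and the copy is onto
    itself.\<close>
  have "h * m \<le> g * m \<or> g * m + m \<le> h * m"
    using row_separated[of g h m] by (cases "g < h") auto
  then obtain n s' where e: "exec update_prog s n s'" "n \<le> 5 * m + 14"
    and regs': "reg s' ''m'' = m" "reg s' ''end'' = w * m" "reg s' ''last'' = h * m"
    and head': "reg s' ''head'' = (if h * m + m < w * m then h * m + m else 0)"
    and cells': "\<And>a. mem s' a = (if h * m \<le> a \<and> a < h * m + m
        then mem s (g * m + (a - h * m)) + (if a = h * m + (p - 1) then 1 else 0) else mem s a)"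
    using exec_update_prog[OF assms(2)] by (auto simp: regs head last g_def p_def)
  define h' where "h' = Suc h mod w"
  have h': "h' < w" using h by (simp add: h'_def)
  have "reg s' ''head'' = h' * m"
  proof (cases "Suc h = w")
    case True
    then show ?thesis by (auto simp: head' h'_def)
  next
    case False
    then have "Suc h < w" using h by simp
    \<comment> \<open>If rows are empty, the strict comparison with \<open>end\<close> fails and the
      head is reset to 0, but then every row has address 0.\<close>
    moreover have "h * m + m < w * m \<or> m = 0" using row_less[of 0 m "Suc h" w] \<open>Suc h < w\<close> by auto
    ultimately show ?thesis by (auto simp: head' h'_def)
  qed
  moreover have last': "(h' + (w - 1)) mod w = h"
    using h by (cases "Suc h = w") (auto simp: h'_def mod_if)
  moreover have "mem s' (((h' + i) mod w) * m + j) = slide l p S ! i ! j"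
    if i: "i < w" and j: "j < m" for i j
  proof (cases "Suc i < w")
    case True
    have r: "(h' + i) mod w = (h + Suc i) mod w"
      by (simp add: h'_def mod_simps)
    let ?r = "(h + Suc i) mod w"
    \<comment> \<open>The offset \<open>Suc i\<close> lies strictly between 0 and \<open>w\<close>,
      so this row is not the overwritten one and keeps its contents.\<close>
    have "?r \<noteq> h"
      using h True by (auto simp: mod_if)
    then have "\<not> (h * m \<le> ?r * m + j \<and> ?r * m + j < h * m + m)"
      using row_separated[of h ?r m] row_less[OF j, of ?r h] by (cases "h < ?r") auto
    then have "mem s' (?r * m + j) = mem s (?r * m + j)"
      by (simp only: cells' if_False)
    then have "mem s' (?r * m + j) = S ! Suc i ! j"
      using cells[OF True j] by simp
    then show ?thesis
      using True i len(1) assms(2) by (simp add: r nth_slide p_def)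
  next
    case False
    then have "i = w - 1" using i by simp
    then have r: "(h' + i) mod w = h" by (simp only: last')
    \<comment> \<open>The new last entry, in row \<open>h\<close>, is the old last entry read from
      row \<open>g\<close>, plus the increment.\<close>
    have "mem s (g * m + j) = S ! (w - 1) ! j"
      using cells[of "w - 1" j] j h unfolding g_def by simp
    then have "mem s' (((h' + i) mod w) * m + j) = S ! (w - 1) ! j + (if j = p - 1 then 1 else 0)"
      using j by (simp add: r cells')
    moreover have "length (last S) = m" using S(1) len(2) by simp
    \<comment> \<open>If \<open>p < l\<close>, index \<open>p - 1\<close> is within the row and the
      list update takes effect; otherwise \<open>p - 1 \<ge> m > j\<close> and neither side is
      incremented.\<close>
    moreover have "p < l \<longleftrightarrow> p \<le> m" "1 \<le> p" using assms(2) by (auto simp: m_def p_def)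
    ultimately show ?thesis
      using False i j len(1) S(2) by (auto simp: nth_slide nth_list_update)
  qed
  ultimately have "stores l w s' (slide l p S)"
    using S(1) len regs' h' length_slide[OF S(1)] length_rows_slide[OF S(1) len(2)]
    unfolding stores_def m_def[symmetric] by (intro conjI exI[of _ h']) auto
  with e show ?thesis unfolding m_def p_def by blast
qed

section \<open>The linear time bound for the forward sketch\<close>

theorem lemma3p3:
  shows "\<exists>T :: nat \<Rightarrow> nat. (\<lambda>l. real (T l)) \<in> O(\<lambda>l. real l) \<and>
    (\<forall>(l::nat) (w::nat) (t :: nat \<Rightarrow> nat) (k::nat) (s::state).
       1 \<le> l \<longrightarrow> 1 \<le> w \<longrightarrow> (\<forall>i\<ge>1. t i \<in> {1..l}) \<longrightarrow>
       stores l w s (forward_sketch l w t k) \<longrightarrow>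
       reg s ''p'' = t (w + k + 1) \<longrightarrow>
       (\<exists>n s'. exec update_prog s n s' \<and> n \<le> T l \<and>
               stores l w s' (forward_sketch l w t (Suc k))))"
proof (intro exI[of _ "\<lambda>l. 5 * (l - 1) + 14"] conjI allI impI)
  \<comment> \<open>For \<open>l \<ge> 1\<close> the bound equals \<open>5 * l + 9\<close>, which is
    at most \<open>14 * l\<close>.\<close>
  have "\<forall>\<^sub>F l in sequentially. norm (real (5 * (l - 1) + 14)) \<le> 14 * norm (real l)"
    using eventually_ge_at_top[of 1] by eventually_elim auto
  then show "(\<lambda>l. real (5 * (l - 1) + 14)) \<in> O(\<lambda>l. real l)"
    by (rule landau_o.bigI[rotated]) simp
next
  fix l w k :: nat and t :: "nat \<Rightarrow> nat" and s :: state
  assume "\<forall>i\<ge>1. t i \<in> {1..l}" "stores l w s (forward_sketch l w t k)"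
    and p: "reg s ''p'' = t (w + k + 1)"
  \<comment> \<open>The arriving item has index \<open>w + k + 1 \<ge> 1\<close>, so its value lies
    in \<open>{1..l}\<close>.\<close>
  moreover from this have "1 \<le> reg s ''p''" by simp
  ultimately show "\<exists>n s'. exec update_prog s n s' \<and> n \<le> 5 * (l - 1) + 14 \<and>
      stores l w s' (forward_sketch l w t (Suc k))"
    using exec_update_prog_stores[of l w s "forward_sketch l w t k"] by simp
qed

end
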